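(* Let $p>1$, let $f,F$ be real numbers with $0<f^p\le F$, and let $k\in(0,1]$. Then there exists a non-increasing and continuous function $g_k:(0,1]\to[0,+\infty)$ satisfying $\int_0^1 g_k=f$ and $\int_0^1 g_k^p=F$ such that $$\int_0^k\left(\frac1t\int_0^t g_k\right)^p dt=\sup\left\{\int_0^k\left(\frac1t\int_0^t g\right)^p dt:\ g:(0,1]\to[0,+\infty)\text{ non-increasing},\ \int_0^1 g=f,\ \int_0^1 g^p=F\right\}.$$
   Context: All integrals over subintervals of $(0,1]$ are with respect to Lebesgue measure. *)

theory Defs
  imports "HOL-Analysis.Analysis"
begin

definition admissible :: "real \<Rightarrow> real \<Rightarrow> real \<Rightarrow> (real \<Rightarrow> real) set" where
  "admissible p f F = {g.
     (\<forall>t\<in>{0<..1}. 0 \<le> g t) \<and>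
     antimono_on {0<..1} g \<and>
     set_integrable lborel {0<..1} g \<and>
     (LBINT t:{0<..1}. g t) = f \<and>
     set_integrable lborel {0<..1} (\<lambda>t. g t powr p) \<and>
     (LBINT t:{0<..1}. g t powr p) = F}"

text \<open>The outer integral takes values in \<open>[0, \<infinity>]\<close>, so that both the integral and the
  supremum over a class of functions are meaningful without an a priori bound. The inner one is a
  finite real number for every admissible \<open>g\<close> and \<open>t \<in> (0, 1]\<close>.\<close>

definition hardy_integral :: "real \<Rightarrow> real \<Rightarrow> (real \<Rightarrow> real) \<Rightarrow> ennreal" where
  "hardy_integral p k g =
     (\<integral>\<^sup>+t\<in>{0<..k}. ennreal ((1 / t * (LBINT s:{0<..t}. g s)) powr p) \<partial>lborel)"

end

theory Submission imports Defs begin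

text \<open>
  Write \<open>M t\<close> for the average of \<open>h\<close> over \<open>(0, t]\<close>. Differentiating \<open>t * M t powr p\<close> and applying
  Young's inequality with a parameter \<open>\<mu> > 1\<close> bounds \<open>(p - 1) (1 - 1/\<mu>) \<integral> M powr p\<close> over \<open>(0, k]\<close> by
  \<open>\<mu> powr (p - 1) \<integral> h powr p - k * M k powr p\<close>, the first integral being again over \<open>(0, k]\<close>. Tangent
  inequalities for \<open>x powr p\<close>, at \<open>c = f / (1 - k + k \<mu>)\<close> for \<open>h\<close> on \<open>[k, 1]\<close> and at \<open>\<mu> c\<close> for \<open>M k\<close>, then
  remove the dependence on \<open>h\<close>. All these inequalities are equalities when \<open>h\<close> is a multiple of the power
  \<open>t powr (1/\<mu> - 1)\<close> on \<open>(0, k]\<close> and the constant \<open>c\<close> on \<open>[k, 1]\<close>, joined continuously at \<open>k\<close>; the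
  intermediate value theorem yields the \<open>\<mu>\<close> for which this function has the prescribed \<open>F\<close>. In the
  degenerate case \<open>F = f powr p\<close> one lets \<open>\<mu>\<close> tend to 1.
\<close>

section \<open>Tangent inequality for powers and a monotonicity criterion\<close>

text \<open>Young's inequality with weights \<open>1/p\<close> and \<open>(p-1)/p\<close>, applied
  to \<open>y powr p\<close> and \<open>x powr p\<close> and multiplied by \<open>p\<close>;
  geometrically, a convex graph lies above its tangent at \<open>x\<close>.\<close>

lemma powr_tangent_le:
  fixes p x y :: real
  assumes "p > 1" "0 \<le> x" "0 \<le> y"
  shows "p * x powr (p - 1) * y \<le> y powr p + (p - 1) * x powr p"
proof (cases "x = 0 \<or> y = 0")
  case False
  have "(y powr p) powr (1/p) * (x powr p) powr ((p-1)/p) \<le> 1/p * y powr p + (p-1)/p * x powr p"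
    using assms False by (intro Youngs_inequality_0) (auto simp: field_simps)
  then have "x powr (p - 1) * y \<le> 1/p * y powr p + (p-1)/p * x powr p"
    using assms False by (simp add: powr_powr mult.commute)
  then show ?thesis
    using assms by (simp add: field_simps)
qed (use assms in auto)

text \<open>If the endpoint values increased, tilting \<open>\<psi>\<close> by a small slope would
  give \<open>\<phi>\<close>, still increasing from \<open>a\<close> to \<open>b\<close> but with
  negative derivative off \<open>C\<close>. Uncountably many levels lie between
  \<open>\<phi> a\<close> and \<open>\<phi> b\<close>, so one of them, \<open>y\<close>, is not
  attained on \<open>C\<close>. At the last point with \<open>\<phi> x \<le> y\<close> the level is
  attained, and the negative derivative pushes \<open>\<phi>\<close> below \<open>y\<close> just
  after it, a contradiction.\<close>

lemma nonincreasing_off_countable: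
  fixes \<psi> \<psi>' :: "real \<Rightarrow> real"
  assumes "a \<le> b" and cont: "continuous_on {a..b} \<psi>" and "countable C"
    and der: "\<And>x. x \<in> {a<..<b} - C \<Longrightarrow> (\<psi> has_real_derivative \<psi>' x) (at x)"
    and le: "\<And>x. x \<in> {a<..<b} - C \<Longrightarrow> \<psi>' x \<le> 0"
  shows "\<psi> b \<le> \<psi> a"
proof (rule ccontr)
  assume "\<not> \<psi> b \<le> \<psi> a"
  then have gt: "\<psi> a < \<psi> b" and ab: "a < b"
    using \<open>a \<le> b\<close> by (auto simp: order_le_less)
  \<comment> \<open>Half the mean slope: the tilt removes only half of the increase from
    \<open>a\<close> to \<open>b\<close>.\<close>
  define d where "d = (\<psi> b - \<psi> a) / 2 / (b - a)"
  have "d > 0" using gt ab by (simp add: d_def)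
  define \<phi> where "\<phi> x = \<psi> x - d * (x - a)" for x
  have "d * (b - a) = (\<psi> b - \<psi> a) / 2"
    using ab by (simp add: d_def field_simps)
  then have "\<phi> a < \<phi> b"
    using gt by (simp add: \<phi>_def)
  then have "uncountable {\<phi> a<..<\<phi> b}"
    by (rule uncountable_open_interval[THEN iffD2])
  moreover have "countable (\<phi> ` (insert a (insert b C)))"
    using \<open>countable C\<close> by blast
  ultimately obtain y where y: "y \<in> {\<phi> a<..<\<phi> b}" "y \<notin> \<phi> ` (insert a (insert b C))"
    by (meson countable_subset subsetI)
  have cont\<phi>: "continuous_on {a..b} \<phi>"
    unfolding \<phi>_def by (intro continuous_intros cont)
  define S where "S = {x \<in> {a..b}. \<phi> x \<le> y}"
  have "closed S"
    unfolding S_def using continuous_on_closed_Collect_le[OF cont\<phi> continuous_on_const] by simp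
  moreover have "a \<in> S" "bdd_above S"
    using ab y by (auto simp: S_def intro: bdd_aboveI[of _ b])
  ultimately have xS: "Sup S \<in> S"
    using closed_contains_Sup by blast
  define x where "x = Sup S"
  have x: "a \<le> x" "x \<le> b" "\<phi> x \<le> y"
    using xS by (auto simp: S_def x_def)
  have "x < b"
    using x y by (cases "x = b") auto
  have above: "y < \<phi> z" if "x < z" "z \<le> b" for z
  proof (rule ccontr)
    assume "\<not> y < \<phi> z"
    then have "z \<in> S" using that x by (auto simp: S_def)
    then show False
      using cSup_upper[OF _ \<open>bdd_above S\<close>] that by (force simp: x_def)
  qed
  obtain z where z: "x \<le> z" "z \<le> b" "\<phi> z = y"
    using IVT'[of \<phi> x y b] x y continuous_on_subset[OF cont\<phi>, of "{x..b}"] by force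
  then have eq: "\<phi> x = y"
    using above[of z] by (cases "x = z") auto
  then have xin: "x \<in> {a<..<b} - C"
    using y x by (cases "x = a"; cases "x = b") auto
  have "(\<phi> has_real_derivative (\<psi>' x - d)) (at x)"
    unfolding \<phi>_def by (auto intro!: derivative_eq_intros der[OF xin])
  moreover have "\<psi>' x - d < 0"
    using le[OF xin] \<open>d > 0\<close> by simp
  ultimately obtain r where r: "r > 0" "\<And>h. 0 < h \<Longrightarrow> h < r \<Longrightarrow> \<phi> (x + h) < \<phi> x"
    using DERIV_neg_dec_right by meson
  define s where "s = min (r/2) (b - x)"
  have "0 < s" "s < r" "x + s \<le> b"
    using \<open>r > 0\<close> \<open>x < b\<close> by (auto simp: s_def)
  then show False
    using r(2)[of s] above[of "x + s"] eq by simp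
qed

lemma integral_powr_tangent_le:
  fixes h :: "real \<Rightarrow> real"
  assumes "p > 1" "0 \<le> x" "a \<le> b" and nn: "\<And>t. t \<in> {a..b} \<Longrightarrow> 0 \<le> h t"
    and h: "h integrable_on {a..b}" and hp: "(\<lambda>t. h t powr p) integrable_on {a..b}"
  shows "p * x powr (p - 1) * integral {a..b} h
    \<le> integral {a..b} (\<lambda>t. h t powr p) + (p - 1) * x powr p * (b - a)"
proof (rule has_integral_le)
  show "((\<lambda>t. p * x powr (p - 1) * h t) has_integral p * x powr (p - 1) * integral {a..b} h) {a..b}"
    by (intro has_integral_mult_right integrable_integral h)
  have "((\<lambda>t. (p - 1) * x powr p) has_integral (b - a) * ((p - 1) * x powr p)) {a..b}"
    using has_integral_const_real[of "(p - 1) * x powr p" a b] \<open>a \<le> b\<close> by simp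
  then show "((\<lambda>t. h t powr p + (p - 1) * x powr p) has_integral
      integral {a..b} (\<lambda>t. h t powr p) + (p - 1) * x powr p * (b - a)) {a..b}"
    using has_integral_add[OF integrable_integral[OF hp]] by (simp add: mult_ac)
qed (use assms powr_tangent_le in auto)

section \<open>Energy estimate and the upper bound away from the origin\<close>

text \<open>Either \<open>h t > 0\<close>, and then \<open>h\<close> is at least \<open>h t\<close>
  on \<open>[t/2, t]\<close>, or \<open>h t = 0\<close>, and then \<open>h\<close> vanishes on
  \<open>[t, 1]\<close> and all the mass lies in \<open>[0, t]\<close>. Positivity of the averages
  is what makes their powers differentiable later.\<close>

lemma antimono_primitive_pos:
  fixes h :: "real \<Rightarrow> real"
  assumes nn: "\<And>t. t \<in> {0..1} \<Longrightarrow> 0 \<le> h t" and anti: "antimono_on {0<..1} h"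
    and h: "h integrable_on {0..1}" and pos: "0 < integral {0..1} h" and t: "0 < t" "t \<le> 1"
  shows "0 < integral {0..t} h"
proof -
  have int: "h integrable_on {a..b}" if "0 \<le> a" "b \<le> 1" for a b
    using that by (intro integrable_on_subinterval[OF h]) auto
  have le: "h s \<le> h r" if "0 < r" "r \<le> s" "s \<le> 1" for r s
    using monotone_onD[OF anti, of r s] that by auto
  have split: "integral {0..b} h = integral {0..a} h + integral {a..b} h"
    if "0 \<le> a" "a \<le> b" "b \<le> 1" for a b
    using that by (intro Henstock_Kurzweil_Integration.integral_combine[symmetric] int) auto
  have "integral {t..1} h \<le> integral {t..1} (\<lambda>_. h t)"
    using t le by (intro integral_le int) auto
  then have 1: "integral {0..1} h \<le> integral {0..t} h + (1 - t) * h t"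
    using split[of t 1] t by simp
  \<comment> \<open>Starting at \<open>t/2\<close> avoids the point 0, where monotonicity says
    nothing.\<close>
  have "integral {t/2..t} (\<lambda>_. h t) \<le> integral {t/2..t} h"
    using t le by (intro integral_le int) auto
  moreover have "0 \<le> integral {0..t/2} h"
    using t by (intro integral_nonneg int nn) auto
  ultimately have 2: "t / 2 * h t \<le> integral {0..t} h"
    using split[of "t/2" t] t by simp
  show ?thesis
  proof (cases "h t = 0")
    case False
    then have "0 < h t" using nn[of t] t by auto
    then have "0 < t / 2 * h t" using t by simp
    with 2 show ?thesis by linarith
  qed (use 1 pos in simp)
qed

text \<open>The function \<open>t * M t powr p\<close> minus the primitive of \<open>D\<close> has
  nonpositive derivative off a countable set. The cutoff \<open>e\<close> keeps away from 0, where
  \<open>M\<close> may be unbounded; the boundary term at \<open>e\<close> is absorbed by the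
  integral of \<open>h powr p\<close> over \<open>[0, e]\<close>.\<close>

lemma hardy_energy_estimate:
  fixes h :: "real \<Rightarrow> real"
  assumes p: "p > 1" and \<mu>: "\<mu> \<ge> 1" and ek: "0 < e" "e \<le> k" "k \<le> 1"
    and nn: "\<And>t. t \<in> {0..1} \<Longrightarrow> 0 \<le> h t" and anti: "antimono_on {0<..1} h"
    and h: "h integrable_on {0..1}" and hp: "(\<lambda>t. h t powr p) integrable_on {0..1}"
    and pos: "0 < integral {0..1} h"
  defines "M \<equiv> \<lambda>t. integral {0..t} h / t"
  shows "(p - 1) * (1 - 1/\<mu>) * integral {e..k} (\<lambda>t. M t powr p) + k * M k powr p
    \<le> \<mu> powr (p - 1) * integral {0..k} (\<lambda>t. h t powr p)"
proof -
  define H where "H t = integral {0..t} h" for t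
  have int: "h integrable_on {a..b}" "(\<lambda>t. h t powr p) integrable_on {a..b}"
    if "0 \<le> a" "b \<le> 1" for a b
    using that by (auto intro!: integrable_on_subinterval[OF h] integrable_on_subinterval[OF hp])
  have Hpos: "0 < H t" if "0 < t" "t \<le> 1" for t
    unfolding H_def using that nn by (intro antimono_primitive_pos[OF _ anti h pos]) auto
  have Mpos: "0 < M t" if "0 < t" "t \<le> 1" for t
    using Hpos[OF that] that by (simp add: M_def H_def)
  have "continuous_on {0..1} H"
    unfolding H_def by (rule indefinite_integral_continuous_1[OF h])
  then have contM: "continuous_on {e..k} M"
    unfolding M_def H_def[symmetric]
    using ek by (intro continuous_intros) (auto elim: continuous_on_subset)
  then have contMp: "continuous_on {e..k} (\<lambda>t. M t powr p)"
    using ek Mpos by (intro continuous_intros) (auto simp: less_le)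
  define D where "D t = \<mu> powr (p - 1) * h t powr p - (p - 1) * (1 - 1/\<mu>) * M t powr p" for t
  have intM: "(\<lambda>t. M t powr p) integrable_on {e..k}"
    by (rule integrable_continuous_real[OF contMp])
  have intD: "D integrable_on {e..k}"
    unfolding D_def using ek by (intro integrable_diff integrable_on_mult_right int intM) auto
  \<comment> \<open>\<open>h\<close> is continuous, hence its primitive differentiable, off a countable set.\<close>
  define C where "C = {x \<in> {0<..1}. \<not> continuous (at x within {0<..1}) (\<lambda>x. - h x)}"
  have "countable C"
    unfolding C_def using anti by (intro mono_on_ctble_discont) (auto simp: monotone_on_def)
  define \<psi> where "\<psi> t = t * M t powr p - integral {e..t} D" for t
  define \<psi>' where "\<psi>' x = p * M x powr (p - 1) * h x - (p - 1) * M x powr p - D x" for x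
  have "\<psi> k \<le> \<psi> e"
  proof (rule nonincreasing_off_countable[OF _ _ \<open>countable C\<close>, where \<psi> = \<psi> and \<psi>' = \<psi>'])
    show "continuous_on {e..k} \<psi>"
      unfolding \<psi>_def by (intro continuous_intros contMp indefinite_integral_continuous_1 intD)
    fix x assume x: "x \<in> {e<..<k} - C"
    then have x01: "0 < x" "x < 1" "e < x" "x < k" using ek by auto
    have at: "at x within {0<..1} = at x" "at x within {0..1} = at x"
      by (auto intro!: at_within_open_subset[of x "{0<..<1}"] simp: x01 less_imp_le)
    have at_ek: "at x within {e..k} = at x"
      by (rule at_within_open_subset[of x "{e<..<k}"]) (auto simp: x01)
    have "continuous (at x) (\<lambda>x. - h x)"
      using x x01 at by (auto simp: C_def)
    then have hcont: "continuous (at x) h"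
      using continuous_minus by fastforce
    have Hd: "(H has_real_derivative h x) (at x)"
      using integral_has_vector_derivative_continuous_at[OF h, of x "{}"] x01 hcont at
      by (simp add: H_def[abs_def] has_real_derivative_iff_has_vector_derivative)
    have Md: "(M has_real_derivative (h x - M x) / x) (at x)"
      unfolding M_def H_def[symmetric] using x01
      by (auto intro!: derivative_eq_intros Hd simp: field_simps)
    have Mx: "0 < M x" using Mpos x01 by simp
    have Mpd: "((\<lambda>t. M t powr p) has_real_derivative p * M x powr (p - 1) * ((h x - M x) / x)) (at x)"
      using DERIV_fun_powr[OF Md Mx, of p] by simp
    have d1: "((\<lambda>t. t * M t powr p) has_real_derivative
        x * (p * M x powr (p - 1) * ((h x - M x) / x)) + M x powr p) (at x)"
      by (rule DERIV_cong[OF DERIV_mult[OF DERIV_ident Mpd]]) simp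
    have eq: "x * (p * M x powr (p - 1) * ((h x - M x) / x)) + M x powr p
        = p * M x powr (p - 1) * h x - (p - 1) * M x powr p"
      using Mx x01 by (simp add: powr_diff field_simps)
    have d2: "((\<lambda>t. integral {e..t} D) has_real_derivative D x) (at x)"
    proof -
      have "isCont M x" using Md by (rule DERIV_isCont)
      then have "isCont (\<lambda>t. M t powr p) x"
        unfolding isCont_def using Mx by (intro tendsto_powr) auto
      moreover have "\<forall>\<^sub>F t in at x. 0 \<le> h t"
        by (rule eventually_mono[OF eventually_at_in_open'[of "{0<..<1}" x]]) (use x01 nn in auto)
      then have "isCont (\<lambda>t. h t powr p) x"
        using hcont p unfolding isCont_def by (intro tendsto_powr2) auto
      ultimately have "continuous (at x) D"
        unfolding D_def by (intro continuous_diff continuous_mult continuous_const)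
      then show ?thesis
        using integral_has_vector_derivative_continuous_at[OF intD, of x "{}"] x01 at_ek
        by (simp add: has_real_derivative_iff_has_vector_derivative)
    qed
    show "(\<psi> has_real_derivative \<psi>' x) (at x)"
      using DERIV_diff[OF d1 d2] by (simp only: eq \<psi>_def[abs_def] \<psi>'_def)
    \<comment> \<open>With the tangent point \<open>M x / \<mu>\<close>, multiplication by
      \<open>\<mu> powr (p - 1)\<close> restores the cross term
      \<open>p * M x powr (p - 1) * h x\<close>, while the term in \<open>M x powr p\<close> only
      costs a factor \<open>1/\<mu>\<close>. This leaves the gain
      \<open>1 - 1/\<mu>\<close>.\<close>
    have "p * (M x / \<mu>) powr (p - 1) * h x \<le> h x powr p + (p - 1) * (M x / \<mu>) powr p"
      using Mx \<mu> nn[of x] x01 by (intro powr_tangent_le[OF p]) auto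
    then have "\<mu> powr (p - 1) * (p * (M x / \<mu>) powr (p - 1) * h x)
        \<le> \<mu> powr (p - 1) * (h x powr p + (p - 1) * (M x / \<mu>) powr p)"
      by (intro mult_left_mono) auto
    moreover have "\<mu> powr (p - 1) * (M x / \<mu>) powr (p - 1) = M x powr (p - 1)"
      using Mx \<mu> by (simp flip: powr_mult)
    moreover have "\<mu> powr (p - 1) * (M x / \<mu>) powr p = M x powr p / \<mu>"
      using Mx \<mu> by (simp add: powr_divide powr_diff)
    ultimately have "p * M x powr (p - 1) * h x
        \<le> \<mu> powr (p - 1) * h x powr p + (p - 1) * (M x powr p / \<mu>)"
      by (simp add: algebra_simps diff_divide_distrib)
    then show "\<psi>' x \<le> 0"
      unfolding \<psi>'_def D_def by (simp add: algebra_simps diff_divide_distrib)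
  qed (use ek in auto)
  moreover have "integral {e..k} D = \<mu> powr (p - 1) * integral {e..k} (\<lambda>t. h t powr p)
      - (p - 1) * (1 - 1/\<mu>) * integral {e..k} (\<lambda>t. M t powr p)"
    unfolding D_def using ek intM
    by (subst integral_diff) (auto intro!: integrable_on_mult_right int)
  \<comment> \<open>Jensen's inequality on \<open>[0, e]\<close>, obtained from the tangent at the
    mean \<open>M e\<close>; then \<open>\<mu> powr (p - 1)\<close> is at least 1.\<close>
  moreover have "e * M e powr p \<le> \<mu> powr (p - 1) * integral {0..e} (\<lambda>t. h t powr p)"
  proof -
    have "p * M e powr (p - 1) * H e \<le> integral {0..e} (\<lambda>t. h t powr p) + (p - 1) * M e powr p * (e - 0)"
      unfolding H_def using ek Mpos[of e] nn by (intro integral_powr_tangent_le[OF p] int) auto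
    moreover have "M e powr (p - 1) * H e = e * M e powr p"
    proof -
      have "H e = e * M e" using ek by (simp add: M_def H_def)
      then show ?thesis using Mpos[of e] ek by (simp add: powr_diff)
    qed
    ultimately have "e * M e powr p \<le> 1 * integral {0..e} (\<lambda>t. h t powr p)"
      by (simp add: algebra_simps)
    also have "\<dots> \<le> \<mu> powr (p - 1) * integral {0..e} (\<lambda>t. h t powr p)"
      using \<mu> p ek by (intro mult_right_mono integral_nonneg int ge_one_powr_ge_zero) auto
    finally show ?thesis .
  qed
  moreover have "integral {0..k} (\<lambda>t. h t powr p)
      = integral {0..e} (\<lambda>t. h t powr p) + integral {e..k} (\<lambda>t. h t powr p)"
    using ek by (intro Henstock_Kurzweil_Integration.integral_combine[symmetric] int) auto
  ultimately show ?thesis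
    by (simp add: \<psi>_def algebra_simps)
qed

text \<open>The energy estimate is combined with tangent inequalities on \<open>[k, 1]\<close> and
  for \<open>M k\<close>, so that nothing about \<open>h\<close> but \<open>f\<close> and
  \<open>F\<close> remains. The bound is independent of \<open>e\<close>, which permits
  \<open>e\<close> to tend to 0.\<close>

lemma hardy_truncated_bound:
  fixes h :: "real \<Rightarrow> real"
  assumes p: "p > 1" and \<mu>: "\<mu> > 1" and ek: "0 < e" "e \<le> k" "k \<le> 1"
    and nn: "\<And>t. t \<in> {0..1} \<Longrightarrow> 0 \<le> h t" and anti: "antimono_on {0<..1} h"
    and h: "(h has_integral f) {0..1}" and hp: "((\<lambda>t. h t powr p) has_integral F) {0..1}"
    and pos: "0 < f"
  shows "integral {e..k} (\<lambda>t. (integral {0..t} h / t) powr p)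
    \<le> \<mu> powr p * (F - (f / (1 - k + k * \<mu>)) powr (p - 1) * f) / ((p - 1) * (\<mu> - 1))"
proof -
  define M where "M t = integral {0..t} h / t" for t
  define E where "E = integral {e..k} (\<lambda>t. M t powr p)"
  define c where "c = f / (1 - k + k * \<mu>)"
  define P0 where "P0 = integral {0..k} (\<lambda>t. h t powr p)"
  define P1 where "P1 = integral {k..1} (\<lambda>t. h t powr p)"
  define A where "A = c powr (p - 1)"
  define L where "L = \<mu> powr (p - 1)"
  note ints = has_integral_integrable[OF h] has_integral_integrable[OF hp]
  have k0: "0 < k" using ek by simp
  have "0 < k * (\<mu> - 1)" using k0 \<mu> by simp
  then have denom: "0 < 1 - k + k * \<mu>" by (simp add: algebra_simps)
  have c: "0 < c" "c * (1 - k + k * \<mu>) = f"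
    using pos denom by (auto simp: c_def)
  have L: "0 < L" using \<mu> by (simp add: L_def)
  have int: "h integrable_on {a..b}" "(\<lambda>t. h t powr p) integrable_on {a..b}"
    if "0 \<le> a" "b \<le> 1" for a b
    using that by (auto intro!: integrable_on_subinterval[OF ints(1)] integrable_on_subinterval[OF ints(2)])
  have M0: "0 \<le> M k"
    unfolding M_def using ek nn by (intro divide_nonneg_nonneg integral_nonneg int) auto
  have P: "F = P0 + P1"
    using Henstock_Kurzweil_Integration.integral_combine[of 0 k 1 "\<lambda>t. h t powr p"] ints ek
      integral_unique[OF hp] by (simp add: P0_def P1_def)
  have Hk: "integral {k..1} h = f - k * M k"
    using Henstock_Kurzweil_Integration.integral_combine[of 0 k 1 h] ints ek
      integral_unique[OF h] by (simp add: M_def)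
  have cp: "c powr p = A * c" "(\<mu> * c) powr (p - 1) = L * A" "(\<mu> * c) powr p = L * A * \<mu> * c"
    using c \<mu> by (auto simp: A_def L_def powr_mult powr_diff)
  have 1: "(p - 1) * (1 - 1/\<mu>) * E + k * M k powr p \<le> L * P0"
    unfolding E_def M_def L_def P0_def
    using hardy_energy_estimate[of p \<mu> e k h] p \<mu> ek nn anti ints integral_unique[OF h] pos by simp
  have "p * A * (f - k * M k) \<le> P1 + (p - 1) * (A * c) * (1 - k)"
    unfolding Hk[symmetric] P1_def cp(1)[symmetric] unfolding A_def
    using ek c nn by (intro integral_powr_tangent_le[OF p] int) auto
  then have 2: "L * (p * A * (f - k * M k)) \<le> L * (P1 + (p - 1) * (A * c) * (1 - k))"
    using L by (intro mult_left_mono) auto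
  \<comment> \<open>The tangent point \<open>\<mu> * c\<close> is the mean over
    \<open>(0, k]\<close> of the extremal function.\<close>
  have "p * (L * A) * M k \<le> M k powr p + (p - 1) * (L * A * \<mu> * c)"
    unfolding cp(3)[symmetric] unfolding cp(2)[symmetric] using M0 c \<mu> by (intro powr_tangent_le[OF p]) auto
  then have 3: "k * (p * (L * A) * M k) \<le> k * (M k powr p + (p - 1) * (L * A * \<mu> * c))"
    using k0 by (intro mult_left_mono) auto
  \<comment> \<open>In the sum, \<open>M k powr p\<close> cancels between 1 and 3, and the terms
    linear in \<open>M k\<close> cancel between 2 and 3 because the tangent slopes at
    \<open>c\<close> and \<open>\<mu> * c\<close> have ratio \<open>L\<close>. The constants combine
    to \<open>c * (1 - k + k * \<mu>)\<close>, which is \<open>f\<close>.\<close>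
  have "(p - 1) * (1 - 1/\<mu>) * E \<le> L * F - p * L * A * f + (p - 1) * L * A * (c * (1 - k + k * \<mu>))"
    using 1 2 3 unfolding P by (simp add: algebra_simps)
  also have "\<dots> = L * (F - A * f)"
    unfolding c by (simp add: algebra_simps)
  finally have "(p - 1) * (1 - 1/\<mu>) * E * \<mu> \<le> L * (F - A * f) * \<mu>"
    using \<mu> by (intro mult_right_mono) auto
  moreover have "(p - 1) * (1 - 1/\<mu>) * E * \<mu> = E * ((p - 1) * (\<mu> - 1))"
    using \<mu> by (simp add: field_simps)
  moreover have "L * (F - A * f) * \<mu> = \<mu> powr p * (F - A * f)"
    using \<mu> by (simp add: L_def powr_diff)
  ultimately have "E * ((p - 1) * (\<mu> - 1)) \<le> \<mu> powr p * (F - A * f)"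
    by simp
  then have "E \<le> \<mu> powr p * (F - A * f) / ((p - 1) * (\<mu> - 1))"
    using p \<mu> by (subst pos_le_divide_eq) auto
  then show ?thesis
    by (simp add: E_def M_def A_def c_def)
qed

section \<open>Transfer to Lebesgue integrals and the upper bound on all of
  \<open>(0, k]\<close>\<close>

lemma has_integral_Ioc_iff_Icc:
  fixes h :: "real \<Rightarrow> real"
  shows "(h has_integral I) {a<..b} \<longleftrightarrow> (h has_integral I) {a..b}"
proof (rule has_integral_spike_set_eq)
  show "negligible {x \<in> {a<..b} - {a..b}. h x \<noteq> 0}" "negligible {x \<in> {a..b} - {a<..b}. h x \<noteq> 0}"
    by (rule negligible_subset[of "{a}"]; auto)+
qed

lemma set_lborel_has_integral_Icc:
  fixes h :: "real \<Rightarrow> real"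
  assumes "set_integrable lborel {a<..b} h" and eq: "\<And>t. t \<in> {a<..b} \<Longrightarrow> h' t = h t"
  shows "(h' has_integral (LBINT t:{a<..b}. h t)) {a..b}"
proof -
  have "(h has_integral (LBINT t:{a<..b}. h t)) {a<..b}"
    using set_borel_integral_eq_integral[OF assms(1)] by (simp add: has_integral_iff)
  then have "(h' has_integral (LBINT t:{a<..b}. h t)) {a<..b}"
    by (rule has_integral_eq[rotated]) (simp add: eq)
  then show ?thesis
    by (simp add: has_integral_Ioc_iff_Icc)
qed

text \<open>Monotone convergence along the intervals \<open>[k / Suc n, k]\<close>, on which the
  truncated bound is uniform in \<open>n\<close>. Finiteness of the left side is thus a
  conclusion.\<close>

lemma hardy_integral_le:
  assumes p: "p > 1" and \<mu>: "\<mu> > 1" and k: "0 < k" "k \<le> 1" and f: "0 < f"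
    and adm: "h \<in> admissible p f F"
  shows "hardy_integral p k h
    \<le> ennreal (\<mu> powr p * (F - (f / (1 - k + k * \<mu>)) powr (p - 1) * f) / ((p - 1) * (\<mu> - 1)))"
    (is "_ \<le> ennreal ?V")
proof -
  \<comment> \<open>The value \<open>h 0\<close> is unconstrained, so it is replaced by a nonnegative one.\<close>
  define h' where "h' t = (if t = 0 then 0 else h t)" for t
  have nn: "0 \<le> h' t" if "t \<in> {0..1}" for t
    using that adm by (auto simp: h'_def admissible_def)
  have anti: "antimono_on {0<..1} h'"
    using adm by (auto simp: h'_def admissible_def monotone_on_def)
  have int: "set_integrable lborel {0<..1} h" "set_integrable lborel {0<..1} (\<lambda>t. h t powr p)"
    and val: "(LBINT t:{0<..1}. h t) = f" "(LBINT t:{0<..1}. h t powr p) = F"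
    using adm by (auto simp: admissible_def)
  have h: "(h' has_integral f) {0..1}"
    using set_lborel_has_integral_Icc[OF int(1), of h'] val by (auto simp: h'_def)
  have hp: "((\<lambda>t. h' t powr p) has_integral F) {0..1}"
    using set_lborel_has_integral_Icc[OF int(2), of "\<lambda>t. h' t powr p"] val by (auto simp: h'_def)
  define m where "m t = (integral {0..t} h' / t) powr p" for t
  have m_nn: "0 \<le> m t" for t by (simp add: m_def)
  have m: "(1 / t * (LBINT s:{0<..t}. h s)) powr p = m t" if "t \<in> {0<..k}" for t
  proof -
    have "set_integrable lborel {0<..t} h"
      using that k by (intro set_integrable_subset[OF int(1)]) auto
    then have "(h' has_integral (LBINT s:{0<..t}. h s)) {0..t}"
      by (rule set_lborel_has_integral_Icc) (auto simp: h'_def)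
    then show ?thesis
      by (simp add: m_def integral_unique)
  qed
  have "continuous_on {0..1} (\<lambda>t. integral {0..t} h')"
    by (intro indefinite_integral_continuous_1 has_integral_integrable[OF h])
  moreover have "0 < integral {0..t} h'" if "0 < t" "t \<le> 1" for t
  proof (rule antimono_primitive_pos[OF nn anti has_integral_integrable[OF h]])
    show "0 < integral {0..1} h'" using f integral_unique[OF h] by simp
  qed (use that in auto)
  ultimately have cont: "continuous_on {e..k} m" if "0 < e" for e
    unfolding m_def using that k
    by (intro continuous_intros) (auto elim!: continuous_on_subset simp: less_le)
  define u where "u n t = ennreal (indicator {k / Suc n..k} t * m t)" for n t
  have u_le: "integral\<^sup>N lborel (u n) \<le> ennreal ?V" for n
  proof -
    have pos: "0 < k / Suc n" using k by simp
    have "(m has_integral integral {k / Suc n..k} m) {k / Suc n..k}"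
      by (intro integrable_integral integrable_continuous_real cont pos)
    then have "integral\<^sup>N lborel (u n) = ennreal (integral {k / Suc n..k} m)"
      unfolding u_def by (intro nn_integral_has_integral_lebesgue m_nn)
    also have "\<dots> \<le> ennreal ?V"
      unfolding m_def using k pos
      by (intro ennreal_leI hardy_truncated_bound[OF p \<mu> _ _ _ nn anti h hp f]) (auto simp: field_simps)
    finally show ?thesis .
  qed
  have "hardy_integral p k h = (\<integral>\<^sup>+t\<in>{0<..k}. ennreal (m t) \<partial>lborel)"
    unfolding hardy_integral_def by (intro set_nn_integral_cong) (simp_all only: m space_lborel space_borel Int_UNIV_left)
  also have "\<dots> \<le> (\<integral>\<^sup>+t. (SUP n. u n t) \<partial>lborel)"
  proof (rule nn_integral_mono)
    fix t
    show "ennreal (m t) * indicator {0<..k} t \<le> (SUP n. u n t)"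
    proof (cases "t \<in> {0<..k}")
      case True
      then obtain n where "k / t < real (Suc n)"
        using reals_Archimedean2[of "k / t"] by (metis less_trans lessI of_nat_less_iff)
      then have "k / Suc n \<le> t"
        using True by (simp add: field_simps)
      then have "ennreal (m t) * indicator {0<..k} t = u n t"
        using True by (simp add: u_def)
      then show ?thesis by (metis SUP_upper UNIV_I)
    qed simp
  qed
  also have "\<dots> = (SUP n. integral\<^sup>N lborel (u n))"
  proof (rule nn_integral_monotone_convergence_SUP)
    show "incseq u"
    proof (intro incseq_SucI le_funI)
      fix n t
      have "k / Suc (Suc n) \<le> k / Suc n"
        using k by (intro divide_left_mono) auto
      then have "{k / Suc n..k} \<subseteq> {k / Suc (Suc n)..k}"
        by (intro atLeastatMost_subset_iff[THEN iffD2]) simp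
      then show "u n t \<le> u (Suc n) t"
        unfolding u_def by (intro ennreal_leI mult_right_mono m_nn) (auto simp: indicator_def)
    qed
    show "u n \<in> borel_measurable lborel" for n
      using borel_measurable_continuous_on_indicator[OF _ cont[of "k / Suc n"]] k
      by (auto simp: u_def[abs_def])
  qed
  also have "\<dots> \<le> ennreal ?V"
    by (intro SUP_least u_le)
  finally show ?thesis .
qed

section \<open>Choice of the exponent and exact integrals of the extremal function\<close>

text \<open>Gauge integrability yields Lebesgue integrability because \<open>u\<close> is
  nonnegative; continuity supplies Borel measurability.\<close>

lemma nonneg_has_integral_lborel_Ioc:
  fixes u :: "real \<Rightarrow> real"
  assumes I: "(u has_integral I) {a..b}" and nn: "\<And>t. t \<in> {a<..b} \<Longrightarrow> 0 \<le> u t"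
    and cont: "continuous_on {a<..b} u"
  shows "set_integrable lborel {a<..b} u" "(LBINT t:{a<..b}. u t) = I"
proof -
  have I': "(u has_integral I) {a<..b}"
    using I by (simp add: has_integral_Ioc_iff_Icc)
  have "has_bochner_integral lborel (\<lambda>t. indicator {a<..b} t * u t) I"
  proof (rule has_bochner_integral_nn_integral)
    show "(\<lambda>t. indicator {a<..b} t * u t) \<in> borel_measurable lborel"
      using borel_measurable_continuous_on_indicator[OF _ cont] by simp
    show "0 \<le> I"
      by (rule has_integral_nonneg[OF I' nn])
    show "(\<integral>\<^sup>+t. ennreal (indicator {a<..b} t * u t) \<partial>lborel) = ennreal I"
      by (rule nn_integral_has_integral_lebesgue[OF nn I'])
  qed (use nn in \<open>auto simp: indicator_def\<close>)
  then show "set_integrable lborel {a<..b} u" "(LBINT t:{a<..b}. u t) = I"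
    by (auto simp: set_integrable_def set_lebesgue_integral_def has_bochner_integral_iff)
qed

lemma has_integral_truncated_powr:
  fixes a k t :: real
  assumes "-1 < a" "0 < t" "t \<le> k"
  shows "((\<lambda>s. (min s k / k) powr a) has_integral t * (t / k) powr a / (a + 1)) {0..t}"
proof -
  have "((\<lambda>s. s powr a / k powr a) has_integral t powr (a + 1) / (a + 1) / k powr a) {0..t}"
    using assms by (intro has_integral_divide has_integral_powr_from_0) auto
  moreover have "t powr (a + 1) / (a + 1) / k powr a = t * (t / k) powr a / (a + 1)"
    using assms by (simp add: powr_add powr_divide mult.commute)
  ultimately have "((\<lambda>s. s powr a / k powr a) has_integral t * (t / k) powr a / (a + 1)) {0..t}"
    by simp
  then show ?thesis
    by (rule has_integral_eq[rotated]) (use assms in \<open>auto simp: powr_divide\<close>)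
qed

lemma has_integral_truncated_powr_1:
  fixes a k :: real
  assumes "-1 < a" "0 < k" "k \<le> 1"
  shows "((\<lambda>s. (min s k / k) powr a) has_integral k / (a + 1) + (1 - k)) {0..1}"
proof (rule has_integral_combine)
  show "((\<lambda>s. (min s k / k) powr a) has_integral k / (a + 1)) {0..k}"
    using has_integral_truncated_powr[of a k k] assms by simp
  have "((\<lambda>s. 1) has_integral (1 - k)) {k..1}"
    using has_integral_const_real[of "1::real" k 1] assms by simp
  then show "((\<lambda>s. (min s k / k) powr a) has_integral (1 - k)) {k..1}"
    by (rule has_integral_eq[rotated]) (use assms in auto)
qed (use assms in auto)

text \<open>The parameter \<open>\<mu> < p / (p - 1)\<close> is encoded by \<open>q = 1 - p + p / \<mu> \<in> (0, 1]\<close>.\<close>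

lemma exists_extremal_exponent:
  fixes p f F k :: real
  assumes p: "p > 1" and f: "0 < f" and F: "f powr p \<le> F" and k: "0 < k" "k \<le> 1"
  obtains q where "0 < q" "q \<le> 1"
    "(f / (1 - k + k * (p / (q + p - 1)))) powr p * (1 - k + k / q) = F"
proof -
  \<comment> \<open>\<open>G q\<close> is the integral of the \<open>p\<close>-th power of the
    extremal function with exponent \<open>(q - 1) / p\<close>, scaled to have integral
    \<open>f\<close>.\<close>
  define G where "G q = (f / (1 - k + k * (p / (q + p - 1)))) powr p * (1 - k + k / q)" for q
  define B where "B = (f / (1 - k + k * (p / (p - 1)))) powr p * k"
  have den: "0 < 1 - k + k * (p / (q + p - 1))" if "0 \<le> q" for q
  proof -
    have "0 < k * (p / (q + p - 1))" using k p that by simp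
    then show ?thesis using k by linarith
  qed
  have B: "0 < B" using den[of 0] f k by (simp add: B_def)
  have F0: "0 < F" using F f by (smt (verit) powr_gt_zero)
  \<comment> \<open>Since \<open>G q\<close> is at least \<open>B / q\<close>, this choice gives
    \<open>G q0 \<ge> F\<close>. At the other end \<open>G 1 = f powr p\<close>, so \<open>F\<close>
    is an intermediate value.\<close>
  define q0 where "q0 = min 1 (B / F)"
  have q0: "0 < q0" "q0 \<le> 1" using B F0 by (auto simp: q0_def)
  have "F \<le> B / q0"
  proof -
    have "q0 \<le> B / F" by (simp add: q0_def)
    then show ?thesis using q0 F0 by (simp add: field_simps)
  qed
  also have "B / q0 \<le> G q0"
  proof -
    have "p / (q0 + p - 1) \<le> p / (p - 1)"
      using p q0 by (intro divide_left_mono) auto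
    then have "k * (p / (q0 + p - 1)) \<le> k * (p / (p - 1))"
      using k by (intro mult_left_mono) auto
    then have "f / (1 - k + k * (p / (p - 1))) \<le> f / (1 - k + k * (p / (q0 + p - 1)))"
      using f den[of q0] q0 by (intro divide_left_mono) (auto intro!: mult_pos_pos den)
    then have "(f / (1 - k + k * (p / (p - 1)))) powr p \<le> (f / (1 - k + k * (p / (q0 + p - 1)))) powr p"
      using f den[of 0] p by (intro powr_mono2) auto
    moreover have "k / q0 \<le> 1 - k + k / q0" "0 \<le> k / q0" using k q0 by auto
    ultimately have "(f / (1 - k + k * (p / (p - 1)))) powr p * (k / q0) \<le> G q0"
      unfolding G_def by (intro mult_mono) auto
    then show ?thesis by (simp add: B_def)
  qed
  finally have "F \<le> G q0" .
  moreover have "G 1 \<le> F" using F p by (simp add: G_def)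
  moreover have "continuous_on {q0..1} G"
    unfolding G_def using q0 p den f by (intro continuous_intros) (force simp: less_le)+
  ultimately obtain q where "q0 \<le> q" "q \<le> 1" "G q = F"
    using IVT2'[of G 1 F q0] q0 by auto
  then show thesis using that[of q] q0 by (simp add: G_def)
qed

text \<open>The quotient \<open>min t k / k\<close> is 1 from \<open>k\<close> on, so one formula
  covers both pieces and continuity needs no gluing. For \<open>c \<ge> 0\<close>, the
  \<open>p\<close>-th power has the same shape with exponent \<open>a * p\<close>, so one integral
  formula serves both constraints.\<close>

definition extremal :: "real \<Rightarrow> real \<Rightarrow> real \<Rightarrow> real \<Rightarrow> real" where
  "extremal c a k t = c * (min t k / k) powr a"

lemma continuous_on_extremal:
  assumes "0 < k" shows "continuous_on {0<..1} (extremal c a k)"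
  unfolding extremal_def using assms by (intro continuous_intros) (auto simp: min_def)

lemma extremal_admissible:
  assumes "p > 1" "0 < k" "k \<le> 1" "0 \<le> c" "a \<le> 0" "-1 < a * p"
    and f: "c * (k / (a + 1) + (1 - k)) = f" and F: "c powr p * (k / (a * p + 1) + (1 - k)) = F"
  shows "extremal c a k \<in> admissible p f F"
proof -
  let ?g = "extremal c a k"
  \<comment> \<open>As \<open>a \<le> 0\<close> and \<open>p > 1\<close>,
    \<open>a * p \<le> a\<close>.\<close>
  have a: "-1 < a"
    using assms mult_left_mono_neg[of 1 p a] by simp
  have nn: "0 \<le> ?g t" for t using assms by (simp add: extremal_def)
  have cont: "continuous_on {0<..1} ?g" using assms by (intro continuous_on_extremal)
  have contp: "continuous_on {0<..1} (\<lambda>t. ?g t powr p)"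
    using nn assms by (intro continuous_on_powr' cont) auto
  have "(?g has_integral f) {0..1}"
    unfolding extremal_def f[symmetric] using a assms
    by (intro has_integral_mult_right has_integral_truncated_powr_1) auto
  note 1 = nonneg_has_integral_lborel_Ioc[OF this nn cont]
  have "((\<lambda>t. c powr p * (min t k / k) powr (a * p)) has_integral F) {0..1}"
    unfolding F[symmetric] using assms
    by (intro has_integral_mult_right has_integral_truncated_powr_1) auto
  then have "((\<lambda>t. ?g t powr p) has_integral F) {0..1}"
    by (rule has_integral_eq[rotated]) (use assms in \<open>auto simp: extremal_def powr_mult powr_powr\<close>)
  note 2 = nonneg_has_integral_lborel_Ioc[OF this _ contp]
  have "antimono_on {0<..1} ?g"
    unfolding monotone_on_def extremal_def using assms
    by (auto intro!: mult_left_mono powr_mono2' divide_right_mono)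
  then show ?thesis
    using 1 2 nn by (simp add: admissible_def)
qed

text \<open>On \<open>(0, k]\<close> the power is an eigenfunction of averaging with eigenvalue
  \<open>1 / (a + 1)\<close>.\<close>

lemma hardy_integral_extremal:
  assumes "p > 1" "0 < k" "k \<le> 1" "0 \<le> c" "a \<le> 0" "-1 < a * p"
  shows "hardy_integral p k (extremal c a k) = ennreal ((c / (a + 1)) powr p * (k / (a * p + 1)))"
proof -
  let ?m = "\<lambda>t. (c / (a + 1)) powr p * (min t k / k) powr (a * p)"
  have a: "-1 < a"
    using assms mult_left_mono_neg[of 1 p a] by simp
  have nn: "0 \<le> extremal c a k t" for t using assms by (simp add: extremal_def)
  have m: "(1 / t * (LBINT s:{0<..t}. extremal c a k s)) powr p = ?m t" if t: "t \<in> {0<..k}" for t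
  proof -
    have "(extremal c a k has_integral c * (t * (t / k) powr a / (a + 1))) {0..t}"
      unfolding extremal_def using a t by (intro has_integral_mult_right has_integral_truncated_powr) auto
    moreover have "continuous_on {0<..t} (extremal c a k)"
      using t assms by (intro continuous_on_subset[OF continuous_on_extremal[of k]]) auto
    ultimately have "(LBINT s:{0<..t}. extremal c a k s) = c * (t * (t / k) powr a / (a + 1))"
      using nn by (intro nonneg_has_integral_lborel_Ioc(2)) auto
    then have "1 / t * (LBINT s:{0<..t}. extremal c a k s) = c / (a + 1) * (min t k / k) powr a"
      using t by simp
    also have "\<dots> powr p = ?m t"
      using a assms t by (subst powr_mult) (auto simp: powr_powr)
    finally show ?thesis .
  qed
  have "((\<lambda>t. (min t k / k) powr (a * p)) has_integral k / (a * p + 1)) {0..k}"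
    using has_integral_truncated_powr[of "a * p" k k] assms by simp
  then have I: "(?m has_integral (c / (a + 1)) powr p * (k / (a * p + 1))) {0<..k}"
    unfolding has_integral_Ioc_iff_Icc by (rule has_integral_mult_right)
  have "hardy_integral p k (extremal c a k) = (\<integral>\<^sup>+t. ennreal (indicator {0<..k} t * ?m t) \<partial>lborel)"
    unfolding hardy_integral_def
  proof (rule nn_integral_cong)
    fix t
    show "ennreal ((1 / t * (LBINT s:{0<..t}. extremal c a k s)) powr p) * indicator {0<..k} t
        = ennreal (indicator {0<..k} t * ?m t)"
    proof (cases "t \<in> {0<..k}")
      case True
      then show ?thesis by (simp only: m indicator_simps mult_1 mult_1_right)
    qed simp
  qed
  also have "\<dots> = ennreal ((c / (a + 1)) powr p * (k / (a * p + 1)))"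
    by (rule nn_integral_has_integral_lebesgue[OF _ I]) simp
  finally show ?thesis .
qed

section \<open>The degenerate case of equality in Jensen's inequality\<close>

text \<open>For \<open>F = f powr p\<close> the numerator of the general bound is also of order
  \<open>\<mu> - 1\<close>; Bernoulli's inequality bounds the quotient by
  \<open>\<mu> powr p * (f powr p * k)\<close>, and \<open>\<mu>\<close> tends to 1 from the
  right.\<close>

lemma hardy_integral_le_equality_case:
  assumes p: "p > 1" and k: "0 < k" "k \<le> 1" and f: "0 < f" and adm: "h \<in> admissible p f (f powr p)"
  shows "hardy_integral p k h \<le> ennreal (f powr p * k)"
proof (rule tendsto_lowerbound)
  show "((\<lambda>\<mu>. ennreal (\<mu> powr p * (f powr p * k))) \<longlongrightarrow> ennreal (f powr p * k)) (at_right 1)"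
    by (rule tendsto_eq_intros tendsto_ennrealI refl | simp)+
  show "\<forall>\<^sub>F \<mu> in at_right 1. hardy_integral p k h \<le> ennreal (\<mu> powr p * (f powr p * k))"
    unfolding eventually_at_filter
  proof (intro always_eventually allI impI)
    fix \<mu> :: real assume "\<mu> \<in> {1<..}"
    then have \<mu>: "1 < \<mu>" by simp
    define y where "y = 1 - k + k * \<mu>"
    have y: "y = 1 + k * (\<mu> - 1)" by (simp add: y_def algebra_simps)
    have ky: "0 < k * (\<mu> - 1)" using k \<mu> by simp
    \<comment> \<open>Bernoulli: \<open>y powr (1 - p) \<ge> 1 - (p - 1) (y - 1)\<close>\<close>
    have "1 - (p - 1) * (k * (\<mu> - 1)) \<le> 1 - (p - 1) * ln y"
      using p ln_add_one_self_le_self[of "k * (\<mu> - 1)"] ky by (simp add: y)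
    also have "\<dots> \<le> exp (- (p - 1) * ln y)"
      using exp_ge_add_one_self[of "- (p - 1) * ln y"] by (simp add: algebra_simps)
    also have "\<dots> = y powr - (p - 1)"
      using ky by (simp add: y powr_def)
    also have "\<dots> = 1 / y powr (p - 1)"
      by (rule powr_minus_divide)
    finally have "1 - 1 / y powr (p - 1) \<le> (p - 1) * (\<mu> - 1) * k" by (simp add: algebra_simps)
    then have "\<mu> powr p * f powr p * (1 - 1 / y powr (p - 1)) \<le> \<mu> powr p * f powr p * ((p - 1) * (\<mu> - 1) * k)"
      by (intro mult_left_mono) auto
    moreover have "f powr p - (f / y) powr (p - 1) * f = f powr p * (1 - 1 / y powr (p - 1))"
    proof -
      have "0 < y" using ky by (simp add: y)
      then have "(f / y) powr (p - 1) * f = f powr p / y powr (p - 1)"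
        using f by (simp add: powr_divide powr_diff[of f])
      then show ?thesis by (simp add: right_diff_distrib)
    qed
    ultimately have "\<mu> powr p * (f powr p - (f / y) powr (p - 1) * f) / ((p - 1) * (\<mu> - 1))
        \<le> \<mu> powr p * (f powr p * k)"
      using p \<mu> by (subst pos_divide_le_eq) (auto simp: mult_ac)
    then show "hardy_integral p k h \<le> ennreal (\<mu> powr p * (f powr p * k))"
      using hardy_integral_le[OF p \<mu> k f adm] unfolding y_def by (meson ennreal_leI order_trans)
  qed
qed auto

section \<open>Matching the upper bound with the value at the extremal function\<close>

theorem theorem1p2:
  fixes p f F k :: real
  assumes "p > 1" and "0 < f" and "f powr p \<le> F" and "0 < k" and "k \<le> 1"
  shows "\<exists>g. g \<in> admissible p f F \<and> continuous_on {0<..1} g \<and>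
           hardy_integral p k g = Sup {hardy_integral p k h | h. h \<in> admissible p f F}"
proof -
  obtain q where q: "0 < q" "q \<le> 1"
    and F: "(f / (1 - k + k * (p / (q + p - 1)))) powr p * (1 - k + k / q) = F"
    using exists_extremal_exponent assms by metis
  define \<mu> where "\<mu> = p / (q + p - 1)"
  define c where "c = f / (1 - k + k * \<mu>)"
  \<comment> \<open>Equivalently \<open>a = 1/\<mu> - 1\<close>.\<close>
  define a where "a = (q - 1) / p"
  have \<mu>: "0 < \<mu>" "\<mu> * (q + p - 1) = p" "1 / (a + 1) = \<mu>"
    using q assms by (auto simp: \<mu>_def a_def field_simps)
  have ap: "a * p + 1 = q" "a \<le> 0"
    using q assms by (auto simp: a_def divide_nonpos_pos)
  have "0 < 1 - k + k * \<mu>"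
    using assms \<mu> by (smt (verit) mult_pos_pos)
  then have c: "0 < c" "c * (1 - k + k * \<mu>) = f"
    using assms by (auto simp: c_def)
  have F: "c powr p * (1 - k + k / q) = F"
    using F by (simp add: c_def \<mu>_def)
  have quot: "x / (a + 1) = x * \<mu>" for x
    using \<mu>(3) by (metis mult.right_neutral times_divide_eq_right)
  define g where "g = extremal c a k"
  have g: "g \<in> admissible p f F"
    unfolding g_def
  proof (rule extremal_admissible)
    show "c * (k / (a + 1) + (1 - k)) = f"
      unfolding quot using c(2) by (subst add.commute)
    show "c powr p * (k / (a * p + 1) + (1 - k)) = F"
      unfolding ap using F by (subst add.commute)
  qed (use assms q ap c in auto)
  have hg: "hardy_integral p k g = ennreal ((c * \<mu>) powr p * (k / q))"
    unfolding g_def quot[symmetric] ap(1)[symmetric]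
    by (rule hardy_integral_extremal) (use assms q ap c in auto)
  \<comment> \<open>The value \<open>q = 1\<close> means \<open>\<mu> = 1\<close>, where the general
    bound would divide by 0; then \<open>F = f powr p\<close>.\<close>
  have le: "hardy_integral p k h \<le> hardy_integral p k g" if h: "h \<in> admissible p f F" for h
  proof (cases "q = 1")
    case True
    then have "\<mu> = 1" using assms by (simp add: \<mu>_def)
    then have "c = f" "F = f powr p" using c F True by auto
    then show ?thesis
      unfolding hg using hardy_integral_le_equality_case[of p k f h] assms h \<open>\<mu> = 1\<close> True by simp
  next
    case False
    then have "1 < \<mu>" using q assms by (simp add: \<mu>_def)
    have "c powr (p - 1) * f = c powr p * (1 - k + k * \<mu>)"
      unfolding c(2)[symmetric] using c(1) by (simp add: powr_diff)
    then have "F - c powr (p - 1) * f = c powr p * (k * (1 / q - \<mu>))"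
      unfolding F[symmetric] by (simp add: algebra_simps)
    \<comment> \<open>The relation between \<open>q\<close> and \<open>\<mu>\<close> produces
      exactly the denominator of the upper bound, which therefore equals the value at
      \<open>g\<close>.\<close>
    also have "1 / q - \<mu> = (p - 1) * (\<mu> - 1) / q"
    proof -
      have "1 - \<mu> * q = (p - 1) * (\<mu> - 1)" using \<mu>(2) by (simp add: algebra_simps)
      then show ?thesis using q by (simp add: field_simps)
    qed
    finally have "\<mu> powr p * (F - c powr (p - 1) * f) / ((p - 1) * (\<mu> - 1)) = (c * \<mu>) powr p * (k / q)"
      using \<open>1 < \<mu>\<close> assms c by (simp add: powr_mult)
    then show ?thesis
      using hardy_integral_le[OF \<open>p > 1\<close> \<open>1 < \<mu>\<close> \<open>0 < k\<close> \<open>k \<le> 1\<close> \<open>0 < f\<close> h] by (simp add: hg c_def)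
  qed
  have "hardy_integral p k g = Sup {hardy_integral p k h | h. h \<in> admissible p f F}"
    using g le by (intro antisym Sup_upper Sup_least) auto
  moreover have "continuous_on {0<..1} g"
    unfolding g_def using assms by (intro continuous_on_extremal)
  ultimately show ?thesis using g by blast
qed

end
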